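(* Every generalized quadrangle, i.e. every partial geometry of order $(s,t,1)$, has the MMS star property.
   Context: A partial geometry of order $(s,t,\alpha)$ is an incidence structure $(\mathcal{P},\mathcal{L})$ of points and lines (each line a set of points) such that: every point lies on exactly $t+1$ lines; every line contains exactly $s+1$ points; for every point $p$ and line $\ell$ with $p\notin\ell$, exactly $\alpha$ lines contain $p$ and meet $\ell$; and any two distinct points lie on at most one common line. A partial geometry has the MMS star property if for every function $f:\mathcal{P}\to\mathbb{R}$ with $\sum_{p}f(p)=0$, the number of lines $\ell$ with $\sum_{p\in\ell}f(p)\ge 0$ is at least $t+1$. *)

theory Defs
  imports Complex_Main
begin

text \<open>
  The point set is taken finite and non-empty. Finiteness gives the sum of a weighting over all
  points its meaning. The empty structure satisfies the four incidence axioms vacuously for all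
  parameters, and it is not regarded as a partial geometry. No lower bounds on the parameters are
  imposed.
\<close>

locale partial_geometry =
  fixes points :: "'a set" and lines :: "'a set set" and s t \<alpha> :: nat
  assumes finite_points: "finite points"
    and points_nonempty: "points \<noteq> {}"
    and line_subset: "\<And>l. l \<in> lines \<Longrightarrow> l \<subseteq> points"
    and lines_through_point: "\<And>p. p \<in> points \<Longrightarrow> card {l \<in> lines. p \<in> l} = t + 1"
    and points_on_line: "\<And>l. l \<in> lines \<Longrightarrow> card l = s + 1"
    and antiflag: "\<And>p l. p \<in> points \<Longrightarrow> l \<in> lines \<Longrightarrow> p \<notin> l \<Longrightarrow>
      card {m \<in> lines. p \<in> m \<and> m \<inter> l \<noteq> {}} = \<alpha>"
    and common_line: "\<And>p q. p \<in> points \<Longrightarrow> q \<in> points \<Longrightarrow> p \<noteq> q \<Longrightarrow>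
      card {l \<in> lines. p \<in> l \<and> q \<in> l} \<le> 1"

abbreviation generalized_quadrangle :: "'a set \<Rightarrow> 'a set set \<Rightarrow> nat \<Rightarrow> nat \<Rightarrow> bool" where
  "generalized_quadrangle points lines s t \<equiv> partial_geometry points lines s t 1"

definition MMS_star_property :: "'a set \<Rightarrow> 'a set set \<Rightarrow> nat \<Rightarrow> bool" where
  "MMS_star_property points lines t \<longleftrightarrow>
    (\<forall>f :: 'a \<Rightarrow> real. (\<Sum>p\<in>points. f p) = 0 \<longrightarrow>
      card {l \<in> lines. (\<Sum>p\<in>l. f p) \<ge> 0} \<ge> t + 1)"

end

theory Submission
  imports Defs
begin

text \<open>
  Let \<open>w l\<close> be the sum of \<open>f\<close> over the line \<open>l\<close>. Since \<open>f\<close> has total sum zero, counting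
  incidences shows that \<open>w\<close> is an eigenvector of the concurrency graph of lines: the values of \<open>w\<close>
  on the other lines that meet \<open>l\<close> add up to \<open>(t - \<alpha>) w l\<close>. Take \<open>\<alpha> = 1\<close> and choose
  \<open>l\<close> with \<open>w l\<close> maximal, so that \<open>w l \<ge> 0\<close>. If at most \<open>t\<close> lines were nonnegative, then at most
  \<open>t - 1\<close> of the at least \<open>t\<close> lines that meet \<open>l\<close> would be; these contribute at most \<open>(t - 1) w l\<close>
  to the sum and the remaining ones a negative amount, a contradiction.
\<close>

context partial_geometry
begin

lemma finite_lines: "finite lines"
  using finite_points line_subset by (meson Pow_iff finite_Pow_iff finite_subset subsetI)

lemma lines_nonempty: "lines \<noteq> {}"
  using points_nonempty lines_through_point by fastforce

text \<open>Double counting of incident point-line pairs. A subfamily \<open>L\<close> is allowed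
  because both all lines and the lines meeting a fixed line are needed.\<close>

lemma sum_over_lines:
  fixes f :: "'a \<Rightarrow> real"
  assumes "L \<subseteq> lines"
  shows "(\<Sum>m\<in>L. \<Sum>p\<in>m. f p) = (\<Sum>p\<in>points. real (card {m \<in> L. p \<in> m}) * f p)"
proof -
  have fin: "finite L"
    using assms finite_lines finite_subset by blast
  have "(\<Sum>m\<in>L. \<Sum>p\<in>m. f p) = (\<Sum>m\<in>L. \<Sum>p | p \<in> points \<and> p \<in> m. f p)"
    using assms line_subset by (intro sum.cong refl arg_cong2[where f = sum]) auto
  also have "\<dots> = (\<Sum>p\<in>points. \<Sum>m | m \<in> L \<and> p \<in> m. f p)"
    by (rule sum.swap_restrict[OF fin finite_points])
  finally show ?thesis by simp
qed

lemma sum_all_lines: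
  fixes f :: "'a \<Rightarrow> real"
  shows "(\<Sum>m\<in>lines. \<Sum>p\<in>m. f p) = (real t + 1) * (\<Sum>p\<in>points. f p)"
  by (simp add: sum_over_lines lines_through_point sum_distrib_left add.commute)

definition lines_meeting :: "'a set \<Rightarrow> 'a set set" where
  "lines_meeting l = {m \<in> lines. m \<noteq> l \<and> m \<inter> l \<noteq> {}}"

lemma lines_meeting_subset: "lines_meeting l \<subseteq> lines"
  by (auto simp: lines_meeting_def)

text \<open>For \<open>p\<close> on \<open>l\<close>, only \<open>l\<close> itself is dropped from
  the \<open>t + 1\<close> lines through \<open>p\<close>. For \<open>p\<close> off
  \<open>l\<close>, no line through \<open>p\<close> equals \<open>l\<close>, so the antiflag axiom
  gives the count.\<close>

lemma card_lines_meeting_through_point: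
  assumes "l \<in> lines" "p \<in> points"
  shows "card {m \<in> lines_meeting l. p \<in> m} = (if p \<in> l then t else \<alpha>)"
proof (cases "p \<in> l")
  case True
  then have "{m \<in> lines_meeting l. p \<in> m} = {m \<in> lines. p \<in> m} - {l}"
    by (auto simp: lines_meeting_def)
  then show ?thesis
    using True assms lines_through_point[of p] by simp
next
  case False
  then have "{m \<in> lines_meeting l. p \<in> m} = {m \<in> lines. p \<in> m \<and> m \<inter> l \<noteq> {}}"
    by (auto simp: lines_meeting_def)
  then show ?thesis
    using False assms antiflag by simp
qed

lemma card_lines_meeting_ge:
  assumes "l \<in> lines"
  shows "t \<le> card (lines_meeting l)"
proof -
  obtain p where p: "p \<in> l"
    using points_on_line[OF assms] by fastforce
  then have "t = card {m \<in> lines_meeting l. p \<in> m}"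
    using assms line_subset card_lines_meeting_through_point[OF assms, of p] by auto
  also have "\<dots> \<le> card (lines_meeting l)"
    by (rule card_mono) (use finite_lines lines_meeting_subset finite_subset in blast)+
  finally show ?thesis .
qed

text \<open>Write the multiplicity of a point as the constant \<alpha> plus \<open>t\<close> -
  \<alpha> on \<open>l\<close>; the constant part vanishes because \<open>f\<close> has total
  zero.\<close>

lemma sum_lines_meeting:
  fixes f :: "'a \<Rightarrow> real"
  assumes "l \<in> lines" and "(\<Sum>p\<in>points. f p) = 0"
  shows "(\<Sum>m\<in>lines_meeting l. \<Sum>p\<in>m. f p) = (real t - real \<alpha>) * (\<Sum>p\<in>l. f p)"
proof -
  have "(\<Sum>m\<in>lines_meeting l. \<Sum>p\<in>m. f p)
      = (\<Sum>p\<in>points. real (if p \<in> l then t else \<alpha>) * f p)"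
    using assms(1)
    by (simp add: sum_over_lines[OF lines_meeting_subset] card_lines_meeting_through_point)
  also have "\<dots> = (\<Sum>p\<in>points. real \<alpha> * f p + (if p \<in> l then (real t - real \<alpha>) * f p else 0))"
    by (intro sum.cong) (auto simp: algebra_simps)
  also have "\<dots> = real \<alpha> * (\<Sum>p\<in>points. f p) + (\<Sum>p\<in>points \<inter> l. (real t - real \<alpha>) * f p)"
    by (simp add: sum.distrib sum_distrib_left sum.inter_restrict[OF finite_points])
  also have "points \<inter> l = l"
    using line_subset[OF assms(1)] by blast
  finally show ?thesis
    by (simp add: assms(2) sum_distrib_left)
qed

end

theorem theorem2:
  fixes points :: "'a set" and lines :: "'a set set" and s t :: nat
  assumes "generalized_quadrangle points lines s t"
  shows "MMS_star_property points lines t"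
  unfolding MMS_star_property_def
proof (intro allI impI)
  interpret partial_geometry points lines s t 1
    by (fact assms)
  fix f :: "'a \<Rightarrow> real"
  assume sum0: "(\<Sum>p\<in>points. f p) = 0"
  define w where "w l = (\<Sum>p\<in>l. f p)" for l
  define N where "N = {l \<in> lines. w l \<ge> 0}"
  have finN: "finite N"
    using finite_lines by (simp add: N_def)
  have "Max (w ` lines) \<in> w ` lines"
    using finite_lines lines_nonempty by simp
  then obtain l where l: "l \<in> lines" "w l = Max (w ` lines)"
    by (metis imageE)
  have max: "w m \<le> w l" if "m \<in> lines" for m
    using that l(2) finite_lines by simp
  have "w l \<ge> 0"
  \<comment> \<open>Otherwise every line sum is negative, whereas all of them together give
    \<open>t + 1\<close> times the total of \<open>f\<close>, which is zero.\<close>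
  proof (rule ccontr)
    assume "\<not> w l \<ge> 0"
    then have "(\<Sum>m\<in>lines. w m) < (\<Sum>m\<in>lines. 0)"
      using max by (intro sum_strict_mono finite_lines lines_nonempty) force
    then show False
      using sum_all_lines[of f] sum0 by (simp add: w_def)
  qed
  then have "l \<in> N"
    using l(1) by (simp add: N_def)
  have "t + 1 \<le> card N"
  proof (rule ccontr)
    define T where "T = lines_meeting l"
    have T: "T \<subseteq> lines" "l \<notin> T" "finite T"
      using lines_meeting_subset finite_lines finite_subset
      by (auto simp: T_def lines_meeting_def)
    assume "\<not> t + 1 \<le> card N"
    moreover have "card (T \<inter> N) < card N"
      using finN \<open>l \<in> N\<close> T(2) by (intro psubset_card_mono) auto
    ultimately have less: "card (T \<inter> N) + 1 \<le> t"
      by simp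
    \<comment> \<open>\<open>T\<close> has at least \<open>t\<close> lines, fewer than
      \<open>t\<close> of them in \<open>N\<close>. A negative line in \<open>T\<close> makes the
      final inequality strict, even if \<open>w l = 0\<close>.\<close>
    then have "T - N \<noteq> {}"
      using card_lines_meeting_ge[OF l(1)] T(3) unfolding T_def[symmetric]
      by (metis Diff_eq_empty_iff Int_absorb2 add_leD1 not_less_eq_eq Suc_eq_plus1 le_trans)
    then have "(\<Sum>m\<in>T - N. w m) < (\<Sum>m\<in>T - N. 0)"
      using T by (intro sum_strict_mono) (auto simp: N_def)
    moreover have "(\<Sum>m\<in>T \<inter> N. w m) \<le> real (card (T \<inter> N)) * w l"
      using T(1) max by (intro sum_bounded_above) auto
    moreover have "real (card (T \<inter> N)) * w l \<le> (real t - 1) * w l"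
      using less \<open>w l \<ge> 0\<close> by (intro mult_right_mono) auto
    moreover have "(\<Sum>m\<in>T. w m) = (\<Sum>m\<in>T \<inter> N. w m) + (\<Sum>m\<in>T - N. w m)"
      by (rule sum.Int_Diff[OF T(3)])
    moreover have "(\<Sum>m\<in>T. w m) = (real t - 1) * w l"
      using sum_lines_meeting[OF l(1) sum0] by (simp add: T_def w_def)
    ultimately show False by simp
  qed
  then show "t + 1 \<le> card {l \<in> lines. (\<Sum>p\<in>l. f p) \<ge> 0}"
    by (simp add: N_def w_def)
qed

end
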